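(* Let $G$ be an abelian group of (finite) order $n$. If there exist an integer $m \geq 3084$ and an abelian group $K$ such that $G = \mathbb{Z}_m \times K$, then $f_{\max}(G) \geq 2^{n/7}$.
   Context: For a finite abelian group $G$ (written additively), a Schur triple is a triple $x,y,z \in G$ (not necessarily distinct) with $x+y=z$. A subset $A \subseteq G$ is sum-free if $A$ contains no Schur triples, i.e. there are no $x,y,z\in A$ with $x+y=z$. A maximal sum-free subset of $G$ is a sum-free set $A \subseteq G$ that is not properly contained in another sum-free subset of $G$. $f_{\max}(G)$ denotes the number of maximal sum-free subsets of $G$. $\mathbb{Z}_m$ is the cyclic group of order $m$. *)

theory Defs
  imports Complex_Main "HOL-Algebra.Elementary_Groups"
begin

(* HOL-Algebra writes abelian groups multiplicatively, so the equation x + y = z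
   appears as x \<otimes> y = z. *)
definition schur_triple :: "('a, 'c) monoid_scheme \<Rightarrow> 'a \<Rightarrow> 'a \<Rightarrow> 'a \<Rightarrow> bool" where
  "schur_triple G x y z \<longleftrightarrow>
     x \<in> carrier G \<and> y \<in> carrier G \<and> z \<in> carrier G \<and> x \<otimes>\<^bsub>G\<^esub> y = z"

definition sum_free :: "('a, 'c) monoid_scheme \<Rightarrow> 'a set \<Rightarrow> bool" where
  "sum_free G A \<longleftrightarrow>
     A \<subseteq> carrier G \<and> \<not> (\<exists>x\<in>A. \<exists>y\<in>A. \<exists>z\<in>A. schur_triple G x y z)"

definition maximal_sum_free :: "('a, 'c) monoid_scheme \<Rightarrow> 'a set \<Rightarrow> bool" where
  "maximal_sum_free G A \<longleftrightarrow> sum_free G A \<and> \<not> (\<exists>B. sum_free G B \<and> A \<subset> B)"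

(* Only meaningful for a finite carrier: card of an infinite set is 0. *)
definition f_max :: "('a, 'c) monoid_scheme \<Rightarrow> nat" where
  "f_max G = card {A. maximal_sum_free G A}"

end

theory Submission
  imports Defs
begin

text \<open>
  Write \<open>m = 9 s + r\<close> with \<open>1 \<le> r \<le> 9\<close> and identify the group with \<open>Z\<^sub>m \<times> K\<close>.  Let \<open>S\<close> consist of
  the two elements \<open>s\<close> and \<open>-2 s\<close> of \<open>Z\<^sub>m\<close>, with trivial \<open>K\<close>-part.  The interval \<open>{3 s + 1..6 s}\<close> times
  \<open>K\<close> is sum-free and splits into columns: the column of \<open>(i, k)\<close>, where \<open>1 \<le> i \<le> s\<close>, consists of
  \<open>3 s + i\<close>, \<open>4 s + i\<close> and \<open>5 s + i\<close>, all with \<open>K\<close>-part \<open>k\<close>.  Two elements of a column differ by \<open>s\<close>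
  or \<open>2 s\<close>, so a sum-free set that contains \<open>S\<close> contains at most one element of each column.  All
  other Schur triples with one member in \<open>S\<close> and two members \<open>x\<close>, \<open>y\<close> in the interval have
  \<open>x + y \<in> S\<close>.  They link the column of \<open>(i, k)\<close> only with that of \<open>(i', k\<^sup>-\<^sup>1)\<close>, where \<open>i + i'\<close> is congruent
  to \<open>r\<close> modulo \<open>s\<close>, and there they form a perfect matching.  A pair of linked columns is therefore a
  triangular prism, and out of the nine ways to take one element from each of the two columns,
  six avoid the matching.

  Sets that take exactly one element of every column, respect the links and avoid the elements
  with first component \<open>5 s + r\<close> are sum-free together with \<open>S\<close>.  Two different ones clash in some column, so they lie in different maximal
  sum-free sets (\<open>card_incompatible_le_f_max\<close>), and it remains to count them.  Two columns
  yield the factor \<open>6\<close>, which is \<open>6 powr (1 / 18)\<close> per element of the group and beats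
  \<open>2 powr (1 / 7)\<close> because \<open>4 ^ 9 = 262144 < 279936 = 6 ^ 7\<close>.  At most four values of \<open>i\<close> are exceptional
  and contribute less: the columns with \<open>i = i'\<close> may be linked to themselves, and the columns with
  \<open>i = r\<close> or \<open>i = s\<close> suffer from the loss of \<open>5 s + r\<close>, which is \<open>-4 s\<close>, the double of an element
  of \<open>S\<close>.  An exceptional column still contributes at least a factor \<open>2\<close> in place of the
  square root of \<open>6\<close> (\<open>card_admissible_ge\<close>).

  The margin between \<open>4 ^ 9\<close> and \<open>6 ^ 7\<close> has to make up for this loss and for the remainder \<open>r\<close>.
  The worst case is \<open>r = 8\<close> with four exceptional values, where \<open>4 ^ (9 s + 8) \<le> (6 ^ (s - 4) * 4 ^ 4) ^ 7\<close>
  is needed; this holds from \<open>s = 342\<close> on, just barely, and \<open>m \<ge> 3084\<close> guarantees \<open>s \<ge> 342\<close>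
  (\<open>four_power_le_six_power_product\<close>).
\<close>

section \<open>Incompatible sum-free sets\<close>

lemma sum_free_extends_to_maximal:
  assumes "finite (carrier G)" and "sum_free G A"
  shows "\<exists>M. maximal_sum_free G M \<and> A \<subseteq> M"
proof -
  let ?F = "{B. sum_free G B \<and> A \<subseteq> B}"
  have "?F \<subseteq> Pow (carrier G)"
    by (auto simp: sum_free_def)
  then have "finite ?F"
    using assms(1) finite_subset by blast
  moreover have "A \<in> ?F"
    using assms(2) by simp
  ultimately obtain M where "M \<in> ?F" and "\<And>B. B \<in> ?F \<Longrightarrow> M \<subseteq> B \<Longrightarrow> M = B"
    using finite_has_maximal2 by (metis (no_types, lifting))
  then show ?thesis
    unfolding maximal_sum_free_def by (intro exI[of _ M]) auto
qed

lemma sum_free_subset: "sum_free G B \<Longrightarrow> A \<subseteq> B \<Longrightarrow> sum_free G A"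
  unfolding sum_free_def by blast

text \<open>
  Two sets whose union is not sum-free have no common sum-free superset, so extending each member
  of a pairwise incompatible family to a maximal sum-free set never merges two members.
\<close>

lemma card_incompatible_le_f_max:
  assumes fin: "finite (carrier G)"
    and sf: "\<And>i. i \<in> I \<Longrightarrow> sum_free G (A i)"
    and inc: "\<And>i j. i \<in> I \<Longrightarrow> j \<in> I \<Longrightarrow> i \<noteq> j \<Longrightarrow> \<not> sum_free G (A i \<union> A j)"
  shows "card I \<le> f_max G"
proof -
  obtain M where M: "\<And>i. i \<in> I \<Longrightarrow> maximal_sum_free G (M i) \<and> A i \<subseteq> M i"
    using sum_free_extends_to_maximal[OF fin sf] by metis
  have "inj_on M I"
  proof (rule inj_onI, rule ccontr)
    fix i j assume ij: "i \<in> I" "j \<in> I" "M i = M j" "i \<noteq> j"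
    then have "A i \<union> A j \<subseteq> M i" "sum_free G (M i)"
      using M[of i] M[of j] by (auto simp: maximal_sum_free_def)
    then show False
      using inc ij sum_free_subset by blast
  qed
  moreover have "M ` I \<subseteq> {A. maximal_sum_free G A}"
    using M by blast
  moreover have "finite {A. maximal_sum_free G A}"
    by (rule finite_subset[of _ "Pow (carrier G)"])
      (use fin in \<open>auto simp: maximal_sum_free_def sum_free_def\<close>)
  ultimately show ?thesis
    unfolding f_max_def by (metis card_image card_mono)
qed

text \<open>
  This moves the whole construction from \<open>Z\<^sub>m \<times> K\<close> to an isomorphic group.
\<close>

lemma sum_free_iso_image:
  assumes h: "h \<in> iso H G" and A: "A \<subseteq> carrier H" and H: "group H"
  shows "sum_free G (h ` A) \<longleftrightarrow> sum_free H A"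
proof -
  have bij: "inj_on h (carrier H)" and surj: "h ` carrier H = carrier G"
    using h by (auto simp: iso_def bij_betw_def)
  have mult: "h (x \<otimes>\<^bsub>H\<^esub> y) = h x \<otimes>\<^bsub>G\<^esub> h y" if "x \<in> carrier H" "y \<in> carrier H" for x y
    using h that by (auto simp: iso_def hom_def)
  have "schur_triple G (h x) (h y) (h z) \<longleftrightarrow> schur_triple H x y z"
    if "x \<in> A" "y \<in> A" "z \<in> A" for x y z
  proof -
    have xyz: "x \<in> carrier H" "y \<in> carrier H" "z \<in> carrier H"
      using A that by auto
    have "h x \<otimes>\<^bsub>G\<^esub> h y = h z \<longleftrightarrow> x \<otimes>\<^bsub>H\<^esub> y = z"
      using mult[of x y] inj_onD[OF bij, of "x \<otimes>\<^bsub>H\<^esub> y" z] xyz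
        group.is_monoid[OF H, THEN monoid.m_closed] by auto
    then show ?thesis
      using xyz surj by (auto simp: schur_triple_def)
  qed
  moreover have "h ` A \<subseteq> carrier G"
    using A surj by blast
  ultimately show ?thesis
    using A by (auto simp: sum_free_def)
qed

section \<open>Counting selections along an involution\<close>

text \<open>
  A selection picks a label at every point of \<open>C\<close>, subject to a constraint \<open>Q\<close> that involves only the
  two labels on an orbit of \<open>\<tau>\<close>.
\<close>

definition selections :: "'x set \<Rightarrow> ('x \<Rightarrow> 'x) \<Rightarrow> 'j set \<Rightarrow> ('x \<Rightarrow> 'j \<Rightarrow> 'j \<Rightarrow> bool) \<Rightarrow> ('x \<Rightarrow> 'j) set" where
  "selections C \<tau> J Q = {c \<in> C \<rightarrow>\<^sub>E J. \<forall>x\<in>C. Q x (c x) (c (\<tau> x))}"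

text \<open>
  The orbits of \<open>\<tau>\<close> are independent of each other, so the number of selections is a product over
  the orbits.  The weight \<open>w x\<close> stands for the square of the share of the point \<open>x\<close> in that product;
  squaring lets an orbit of two points split its factor into natural numbers.  The
  induction removes one orbit at a time.
\<close>

lemma card_selections_ge:
  fixes w :: "'x \<Rightarrow> nat"
  assumes C: "finite C" and J: "finite J"
    and inv: "\<And>x. x \<in> C \<Longrightarrow> \<tau> x \<in> C \<and> \<tau> (\<tau> x) = x"
    and sym: "\<And>x p q. x \<in> C \<Longrightarrow> Q x p q \<Longrightarrow> Q (\<tau> x) q p"
    and pair: "\<And>x. x \<in> C \<Longrightarrow> \<tau> x \<noteq> x \<Longrightarrow> w x * w (\<tau> x) \<le> (card {(p, q) \<in> J \<times> J. Q x p q})\<^sup>2"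
    and fixed: "\<And>x. x \<in> C \<Longrightarrow> \<tau> x = x \<Longrightarrow> w x \<le> (card {p \<in> J. Q x p p})\<^sup>2"
  shows "(\<Prod>x\<in>C. w x) \<le> (card (selections C \<tau> J Q))\<^sup>2"
  using C inv sym pair fixed
proof (induction C rule: finite_psubset_induct)
  case (psubset C)
  note inv = psubset.prems(1) and sym = psubset.prems(2)
  have finsel: "finite (selections D \<tau> J Q)" if "D \<subseteq> C" for D
    unfolding selections_def
    using finite_PiE[of D "\<lambda>_. J"] finite_subset[OF that psubset.hyps(1)] J by simp
  show ?case
  proof (cases "C = {}")
    case True
    then have "selections C \<tau> J Q = {\<lambda>_. undefined}"
      by (auto simp: selections_def)
    with True show ?thesis by simp
  next
    case False
    then obtain x where x: "x \<in> C" by blast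
    let ?D = "C - {x, \<tau> x}"
    have tD: "\<tau> y \<in> ?D \<and> \<tau> (\<tau> y) = y" if "y \<in> ?D" for y
      using that inv[of y] inv[of x] x by (metis Diff_iff insert_iff singletonD)
    have IH: "(\<Prod>y\<in>?D. w y) \<le> (card (selections ?D \<tau> J Q))\<^sup>2"
      by (rule psubset.IH) (use x tD psubset.prems in auto)
    show ?thesis
    proof (cases "\<tau> x = x")
      case True
      let ?O = "{p \<in> J. Q x p p}"
      let ?g = "\<lambda>(p, c). c(x := p)"
      have "inj_on ?g (?O \<times> selections ?D \<tau> J Q)"
      proof (rule inj_onI, clarify)
        fix p c p' c'
        assume c: "c \<in> selections ?D \<tau> J Q" "c' \<in> selections ?D \<tau> J Q"
          and eq: "c(x := p) = c'(x := p')"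
        have "c x = undefined" "c' x = undefined"
          using c by (auto simp: selections_def PiE_def extensional_def)
        then show "p = p' \<and> c = c'"
          using eq by (metis fun_upd_same fun_upd_triv fun_upd_upd)
      qed
      moreover have "?g ` (?O \<times> selections ?D \<tau> J Q) \<subseteq> selections C \<tau> J Q"
      proof (clarify)
        fix p c assume p: "p \<in> J" "Q x p p" and c: "c \<in> selections ?D \<tau> J Q"
        have "Q y ((c(x := p)) y) ((c(x := p)) (\<tau> y))" if "y \<in> C" for y
          using that p c tD[of y] True by (cases "y = x") (auto simp: selections_def)
        moreover have "c(x := p) \<in> C \<rightarrow>\<^sub>E J"
          using c p x True by (auto simp: selections_def PiE_def extensional_def Pi_def)
        ultimately show "c(x := p) \<in> selections C \<tau> J Q"
          by (simp add: selections_def)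
      qed
      ultimately have le: "card ?O * card (selections ?D \<tau> J Q) \<le> card (selections C \<tau> J Q)"
        using card_inj_on_le[OF _ _ finsel[OF order_refl]] unfolding card_cartesian_product[symmetric] by blast
      have "(\<Prod>y\<in>C. w y) = w x * (\<Prod>y\<in>?D. w y)"
        using prod.remove[OF psubset.hyps(1) x, of w] True by simp
      also have "\<dots> \<le> (card ?O)\<^sup>2 * (card (selections ?D \<tau> J Q))\<^sup>2"
        by (rule mult_le_mono[OF psubset.prems(4)[OF x True] IH])
      also have "\<dots> \<le> (card (selections C \<tau> J Q))\<^sup>2"
        using power_mono[OF le, of 2] by (simp only: power_mult_distrib)
      finally show ?thesis .
    next
      case False
      let ?O = "{(p, q) \<in> J \<times> J. Q x p q}"
      let ?g = "\<lambda>((p, q), c). c(x := p, \<tau> x := q)"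
      have "inj_on ?g (?O \<times> selections ?D \<tau> J Q)"
      proof (rule inj_onI, clarify)
        fix p q c p' q' c'
        assume c: "c \<in> selections ?D \<tau> J Q" "c' \<in> selections ?D \<tau> J Q"
          and eq: "c(x := p, \<tau> x := q) = c'(x := p', \<tau> x := q')"
        have u: "c x = undefined" "c' x = undefined" "c (\<tau> x) = undefined" "c' (\<tau> x) = undefined"
          using c by (auto simp: selections_def PiE_def extensional_def)
        have e: "(c(x := p, \<tau> x := q)) y = (c'(x := p', \<tau> x := q')) y" for y
          using eq by simp
        have "p = p'" "q = q'"
          using e[of x] e[of "\<tau> x"] False by auto
        moreover have "c y = c' y" for y
          using e[of y] u by (auto split: if_splits)
        ultimately show "(p, q) = (p', q') \<and> c = c'"
          by blast
      qed
      moreover have "?g ` (?O \<times> selections ?D \<tau> J Q) \<subseteq> selections C \<tau> J Q"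
      proof (clarify)
        fix p q c assume p: "p \<in> J" "q \<in> J" "Q x p q" and c: "c \<in> selections ?D \<tau> J Q"
        let ?c = "c(x := p, \<tau> x := q)"
        have "Q y (?c y) (?c (\<tau> y))" if y: "y \<in> C" for y
        proof -
          consider "y = x" | "y = \<tau> x" | "y \<in> ?D"
            using y by blast
          then show ?thesis
          proof cases
            case 1
            then show ?thesis using p False by simp
          next
            case 2
            then show ?thesis using p False sym[OF x p(3)] inv[OF x] by simp
          next
            case 3
            then show ?thesis using c tD[OF 3] by (auto simp: selections_def)
          qed
        qed
        moreover have "?c \<in> C \<rightarrow>\<^sub>E J"
          using c p x inv[OF x] by (auto simp: selections_def PiE_def extensional_def Pi_def)
        ultimately show "?c \<in> selections C \<tau> J Q"
          by (simp add: selections_def)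
      qed
      ultimately have le: "card ?O * card (selections ?D \<tau> J Q) \<le> card (selections C \<tau> J Q)"
        using card_inj_on_le[OF _ _ finsel[OF order_refl]] unfolding card_cartesian_product[symmetric] by blast
      have "(\<Prod>y\<in>C. w y) = w x * (\<Prod>y\<in>C - {x}. w y)"
        using prod.remove[OF psubset.hyps(1) x, of w] .
      also have "\<dots> = w x * (w (\<tau> x) * (\<Prod>y\<in>?D. w y))"
        using prod.remove[of "C - {x}" "\<tau> x" w] psubset.hyps(1) inv[OF x] False
        by (simp add: Diff_insert2[symmetric] insert_commute)
      also have "\<dots> = (w x * w (\<tau> x)) * (\<Prod>y\<in>?D. w y)"
        by simp
      also have "\<dots> \<le> (card ?O)\<^sup>2 * (card (selections ?D \<tau> J Q))\<^sup>2"
        by (rule mult_le_mono[OF psubset.prems(3)[OF x False] IH])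
      also have "\<dots> \<le> (card (selections C \<tau> J Q))\<^sup>2"
        using power_mono[OF le, of 2] by (simp only: power_mult_distrib)
      finally show ?thesis .
    qed
  qed
qed

section \<open>Comparing powers of six and four\<close>

text \<open>
  After cancelling powers of two this is \<open>2 ^ 3750 \<le> 3 ^ 2366\<close>, where the two sides differ by
  less than two percent.  The exponents must therefore come from very good rational
  approximations of the binary logarithm of \<open>3\<close> from below: \<open>84 / 53\<close> and \<open>1054 / 665\<close> are convergents of its
  continued fraction, and \<open>2366 = 3 * 665 + 7 * 53\<close>.
\<close>

lemma power_comparison_at_342:
  "(4::nat) ^ (9 * 342 + 8) \<le> (6 ^ 338 * 4 ^ 4) ^ 7"
proof -
  have a: "(2::nat) ^ 1054 \<le> 3 ^ 665" and b: "(2::nat) ^ 84 \<le> 3 ^ 53"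
    by simp_all
  have four: "(4::nat) ^ k = 2 ^ (2 * k)" and six: "(6::nat) ^ k = 2 ^ k * 3 ^ k" for k
    by (simp_all add: power_mult flip: power_mult_distrib)
  have e: "2 * (9 * 342 + 8) = 2422 + (1054 * 3 + 84 * (7::nat))"
    "338 * 7 + 2 * (4 * 7) = (2422::nat)" "338 * 7 = 665 * 3 + 53 * (7::nat)"
    by simp_all
  have "(4::nat) ^ (9 * 342 + 8) = 2 ^ (2422 + (1054 * 3 + 84 * 7))"
    unfolding four e(1) ..
  also have "\<dots> = 2 ^ 2422 * ((2 ^ 1054) ^ 3 * (2 ^ 84) ^ 7)"
    by (simp only: power_add power_mult)
  also have "\<dots> \<le> 2 ^ 2422 * ((3 ^ 665) ^ 3 * (3 ^ 53) ^ 7)"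
    by (intro mult_le_mono power_mono a b order_refl zero_le)
  also have "\<dots> = 2 ^ 2422 * 3 ^ (665 * 3 + 53 * 7)"
    by (simp only: power_add power_mult)
  also have "\<dots> = 2 ^ (338 * 7 + 2 * (4 * 7)) * 3 ^ (338 * 7)"
    by (simp only: e(2) e(3)[symmetric])
  also have "\<dots> = 6 ^ (338 * 7) * 4 ^ (4 * 7)"
    unfolding four six power_add by (simp only: mult_ac)
  also have "\<dots> = (6 ^ 338 * 4 ^ 4) ^ 7"
    by (simp only: power_mult power_mult_distrib)
  finally show ?thesis .
qed

text \<open>
  Raising \<open>s\<close> by one multiplies the left side by \<open>4 ^ 9\<close> and the right side by the larger \<open>6 ^ 7\<close>, so the
  case \<open>s = 342\<close> suffices.  For \<open>r = 9\<close> the missing factor \<open>4\<close> is paid for by having one exceptional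
  value fewer, which gains \<open>(6 / 4) ^ 7\<close>.
\<close>

lemma four_power_le_six_power_product:
  fixes s r e :: nat
  assumes s: "342 \<le> s" and e: "e \<le> 4" and r: "r \<le> 9" and er: "e \<le> 3 \<or> r \<le> 8"
  shows "4 ^ (9 * s + r) \<le> ((6::nat) ^ (s - e) * 4 ^ e) ^ 7"
proof -
  have exchange: "(6::nat) ^ (s - d) * 4 ^ d \<le> 6 ^ (s - e) * 4 ^ e" if "e \<le> d" "d \<le> 4" for d
  proof -
    have "s - e = (s - d) + (d - e)" "d = e + (d - e)"
      using that s by auto
    then have eqs: "(6::nat) ^ (s - e) = 6 ^ (s - d) * 6 ^ (d - e)"
        "(4::nat) ^ d = 4 ^ e * 4 ^ (d - e)"
      by (metis power_add)+
    have "(4::nat) ^ (d - e) \<le> 6 ^ (d - e)"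
      by (rule power_mono) auto
    then show ?thesis
      unfolding eqs by simp
  qed
  obtain t where t: "s = 342 + t"
    using s le_Suc_ex by blast
  have "(4::nat) ^ (9 * s + 8) = 4 ^ (9 * 342 + 8) * (4 ^ 9) ^ t"
    unfolding power_mult[symmetric] power_add[symmetric] t distrib_left by (simp only: add_ac)
  also have "\<dots> \<le> (6 ^ 338 * 4 ^ 4) ^ 7 * (6 ^ 7) ^ t"
    by (intro mult_le_mono power_comparison_at_342 power_mono zero_le) simp
  also have "\<dots> = (6 ^ (338 + t) * 4 ^ 4) ^ 7"
    by (simp only: power_add power_mult_distrib power_mult[symmetric] mult.commute[of 7 t] mult_ac)
  also have "338 + t = s - 4"
    using t by simp
  finally have main: "(4::nat) ^ (9 * s + 8) \<le> (6 ^ (s - 4) * 4 ^ 4) ^ 7" .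
  show ?thesis
  proof (cases "r \<le> 8")
    case True
    then have "(4::nat) ^ (9 * s + r) \<le> 4 ^ (9 * s + 8)"
      by (intro power_increasing) auto
    also note main
    also have "((6::nat) ^ (s - 4) * 4 ^ 4) ^ 7 \<le> (6 ^ (s - e) * 4 ^ e) ^ 7"
      using exchange[of 4] e by (intro power_mono) auto
    finally show ?thesis .
  next
    case False
    then have r9: "r = 9" and e3: "e \<le> 3"
      using r er by auto
    define X :: nat where "X = 6 ^ (s - 4) * 4 ^ 3"
    have "s - 3 = Suc (s - 4)"
      using s by simp
    then have X: "6 ^ (s - 4) * 4 ^ 4 = X * 4" "6 ^ (s - 3) * 4 ^ 3 = X * 6"
      by (simp_all add: X_def)
    have "(4::nat) ^ (9 * s + r) = 4 ^ (9 * s + 8) * 4"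
      unfolding r9 by (simp add: power_add)
    also have "\<dots> \<le> (X * 4) ^ 7 * 4"
      by (rule mult_le_mono1[OF main[unfolded X(1)]])
    also have "\<dots> \<le> (X * 6) ^ 7"
      by (simp add: power_mult_distrib)
    also have "\<dots> \<le> (6 ^ (s - e) * 4 ^ e) ^ 7"
      using exchange[of 3] e3 X by (intro power_mono) auto
    finally show ?thesis .
  qed
qed

section \<open>Columns of the middle third\<close>

text \<open>
  The modulus is \<open>m = 9 s + r\<close>.  Taking \<open>1 \<le> r\<close> rather than \<open>0 \<le> r\<close> keeps the columns \<open>r\<close> and \<open>s\<close>
  apart and leaves \<open>6 s + r = -3 s\<close>, the difference of the two elements of \<open>S\<close>, above the interval
  \<open>{3 s + 1..6 s}\<close>.
\<close>

locale column_decomposition =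
  fixes K :: "('b, 'd) monoid_scheme" and s r :: nat
  assumes K: "comm_group K" and finK: "finite (carrier K)"
    and r_pos: "1 \<le> r" and r_less: "r < s"
begin

sublocale K: comm_group K
  by (rule K)

abbreviation H :: "(int \<times> 'b) monoid" where
  "H \<equiv> integer_mod_group (9 * s + r) \<times>\<times> K"

definition columns :: "(nat \<times> 'b) set" where
  "columns = {1..s} \<times> carrier K"

text \<open>
  The involution of \<open>{1..s}\<close> for which \<open>i + reflect i\<close> is congruent to \<open>r\<close> modulo \<open>s\<close>.
\<close>

definition reflect :: "nat \<Rightarrow> nat" where
  "reflect i = (if i < r then r - i else s + r - i)"

definition partner :: "nat \<times> 'b \<Rightarrow> nat \<times> 'b" where
  "partner = (\<lambda>(i, k). (reflect i, inv\<^bsub>K\<^esub> k))"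

text \<open>
  The label \<open>j\<close> of a column stands for its element \<open>j s + i\<close>.  Modulo \<open>m\<close>, the elements \<open>s\<close> and \<open>-2 s\<close>
  of \<open>S\<close> are \<open>10 s + r\<close> and \<open>7 s + r\<close>.  If \<open>i + i'\<close> equals \<open>r\<close>, labels \<open>p\<close> and \<open>q\<close> thus give a
  sum in \<open>S\<close> for \<open>p + q \<in> {7, 10}\<close>; if it equals \<open>s + r\<close>, for \<open>p + q \<in> {6, 9}\<close>.  Label \<open>5\<close> in column \<open>r\<close>
  is \<open>5 s + r = -4 s\<close>; excluding it for all \<open>k\<close>, not just the trivial one, makes the count uniform in
  \<open>k\<close>.  The condition at \<open>i = s\<close> repeats the exclusion from the side of the partner, so that the
  relation is symmetric.
\<close>

definition compatible :: "nat \<times> 'b \<Rightarrow> nat \<Rightarrow> nat \<Rightarrow> bool" where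
  "compatible = (\<lambda>(i, k) p q. (p + q) mod 3 \<noteq> (if i < r then 1 else 0) \<and>
     (i = r \<longrightarrow> p \<noteq> 5) \<and> (i = s \<longrightarrow> q \<noteq> 5))"

abbreviation admissible :: "(nat \<times> 'b \<Rightarrow> nat) set" where
  "admissible \<equiv> selections columns partner {3, 4, 5} compatible"

definition vertex :: "(nat \<times> 'b \<Rightarrow> nat) \<Rightarrow> nat \<times> 'b \<Rightarrow> nat \<times> 'b" where
  "vertex c = (\<lambda>(i, k). (c (i, k) * s + i, k))"

text \<open>
  The chosen elements together with \<open>S\<close>, with residues as natural numbers below \<open>m\<close>, where
  \<open>7 s + r\<close> represents \<open>-2 s\<close>.
\<close>

definition chosen_pairs :: "(nat \<times> 'b \<Rightarrow> nat) \<Rightarrow> (nat \<times> 'b) set" where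
  "chosen_pairs c = insert (s, \<one>\<^bsub>K\<^esub>) (insert (7 * s + r, \<one>\<^bsub>K\<^esub>) (vertex c ` columns))"

definition chosen_set :: "(nat \<times> 'b \<Rightarrow> nat) \<Rightarrow> (int \<times> 'b) set" where
  "chosen_set c = map_prod int id ` chosen_pairs c"

lemma reflect_range: "i \<in> {1..s} \<Longrightarrow> reflect i \<in> {1..s}"
  using r_pos r_less by (auto simp: reflect_def)

lemma reflect_reflect: "i \<in> {1..s} \<Longrightarrow> reflect (reflect i) = i"
  using r_pos r_less by (auto simp: reflect_def)

lemma chosen_pairs_cases:
  assumes "(a, k) \<in> chosen_pairs c" and c: "c \<in> admissible"
  obtains (short) "a = s" "k = \<one>\<^bsub>K\<^esub>"
    | (long) "a = 7 * s + r" "k = \<one>\<^bsub>K\<^esub>"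
    | (mid) j i where "a = j * s + i" "c (i, k) = j" "j \<in> {3, 4, 5}" "1 \<le> i" "i \<le> s"
        "k \<in> carrier K" "i = r \<longrightarrow> j \<noteq> 5"
proof -
  from assms(1) consider "a = s" "k = \<one>\<^bsub>K\<^esub>" | "a = 7 * s + r" "k = \<one>\<^bsub>K\<^esub>"
    | i where "a = c (i, k) * s + i" "(i, k) \<in> columns"
    unfolding chosen_pairs_def vertex_def by auto
  then show thesis
  proof cases
    case 3
    then have "c (i, k) \<in> {3, 4, 5}" "compatible (i, k) (c (i, k)) (c (partner (i, k)))"
      using c unfolding selections_def by blast+
    then show thesis
      using 3 by (intro mid[of "c (i, k)" i]) (auto simp: columns_def compatible_def)
  qed (use short long in auto)
qed

text \<open>
  Adding an element of \<open>S\<close> to a chosen element shifts it by \<open>s\<close> or by \<open>-2 s\<close>, which either stays in the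
  column, where nothing else is chosen, or leaves the interval.  The sums of two elements of
  \<open>S\<close> are \<open>2 s\<close>, \<open>-s\<close> and the excluded \<open>-4 s\<close>, and their differences \<open>0\<close> and \<open>\<plusminus> 3 s\<close> lie outside the
  interval.
\<close>

lemma no_schur_with_difference:
  assumes c: "c \<in> admissible" and a: "a = s \<or> a = 7 * s + r"
    and b: "(b, l) \<in> chosen_pairs c" and d: "(d, l) \<in> chosen_pairs c"
    and sum: "a + b = d \<or> a + b = d + (9 * s + r)"
  shows False
  using d c
proof (cases rule: chosen_pairs_cases)
  case short
  with b c show False
    by (cases rule: chosen_pairs_cases) (use a sum r_pos r_less short in auto)
next
  case long
  with b c show False
    by (cases rule: chosen_pairs_cases) (use a sum r_pos r_less long in auto)
next
  case d: (mid j i)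
  from b c show False
  proof (cases rule: chosen_pairs_cases)
    case short
    then show ?thesis
      using a sum r_pos r_less d by auto
  next
    case long
    then show ?thesis
      using a sum r_pos r_less d by auto
  next
    case b: (mid j' i')
    have "i = i'"
      using a sum r_pos r_less d b by auto
    then have "j = j'"
      using b d by simp
    with \<open>i = i'\<close> show ?thesis
      using a sum r_pos r_less d b by auto
  qed
qed

text \<open>
  Two chosen elements have a sum in \<open>{6 s + 2..12 s}\<close>, which modulo \<open>m\<close> misses the interval
  \<open>{3 s + 1..6 s}\<close>.  It meets \<open>S\<close> only if the columns are partners, and then \<open>compatible\<close> excludes it.
\<close>

lemma no_schur_in_middle:
  assumes c: "c \<in> admissible"
    and a: "a = j * s + i" "c (i, k) = j" "j \<in> {3, 4, 5}" "1 \<le> i" "i \<le> s" "k \<in> carrier K"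
    and b: "b = j' * s + i'" "c (i', l) = j'" "j' \<in> {3, 4, 5}" "1 \<le> i'" "i' \<le> s" "l \<in> carrier K"
    and d: "(d, k \<otimes>\<^bsub>K\<^esub> l) \<in> chosen_pairs c"
    and sum: "a + b = d \<or> a + b = d + (9 * s + r)"
  shows False
proof -
  have no_reflection: False
    if kl: "k \<otimes>\<^bsub>K\<^esub> l = \<one>\<^bsub>K\<^esub>" and sum': "a + b = 10 * s + r \<or> a + b = 7 * s + r"
  proof -
    have l: "l = inv\<^bsub>K\<^esub> k"
      using kl a(6) b(6) by (metis K.inv_equality K.m_comm)
    have "i' = reflect i \<and> (j + j') mod 3 = (if i < r then 1 else 0)"
      using sum' a b r_pos r_less by (auto simp: reflect_def)
    moreover have "compatible (i, k) (c (i, k)) (c (partner (i, k)))"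
      using c a by (auto simp: selections_def columns_def)
    ultimately show False
      using a b l by (auto simp: compatible_def partner_def)
  qed
  from d c show False
  proof (cases rule: chosen_pairs_cases)
    case short
    then show ?thesis
      using no_reflection sum a b by auto
  next
    case long
    then show ?thesis
      using no_reflection sum a b by auto
  next
    case (mid j'' i'')
    then show ?thesis
      using sum a b r_pos by auto
  qed
qed

lemma chosen_pairs_carrier:
  assumes "c \<in> admissible" and "(a, k) \<in> chosen_pairs c"
  shows "a < 9 * s + r \<and> k \<in> carrier K"
  using assms(2,1) by (cases rule: chosen_pairs_cases) (use r_less in auto)

lemma no_schur_in_chosen_pairs:
  assumes c: "c \<in> admissible" and a: "(a, k) \<in> chosen_pairs c" and b: "(b, l) \<in> chosen_pairs c"
    and d: "(d, k \<otimes>\<^bsub>K\<^esub> l) \<in> chosen_pairs c"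
    and sum: "a + b = d \<or> a + b = d + (9 * s + r)"
  shows False
proof -
  have carr: "k \<in> carrier K" "l \<in> carrier K"
    using chosen_pairs_carrier c a b by blast+
  have left: False if "a = s \<or> a = 7 * s + r" "k = \<one>\<^bsub>K\<^esub>"
    using no_schur_with_difference[OF c that(1) b _ sum] d carr that(2) by simp
  have right: False if "b = s \<or> b = 7 * s + r" "l = \<one>\<^bsub>K\<^esub>"
    using no_schur_with_difference[OF c that(1) a _ sum[unfolded add.commute[of a b]]] d carr that(2)
    by simp
  from a c show False
  proof (cases rule: chosen_pairs_cases)
    case a: (mid j i)
    from b c show False
    proof (cases rule: chosen_pairs_cases)
      case b: (mid j' i')
      show False
        by (rule no_schur_in_middle[OF c a(1-6) b(1-6) d sum])
    qed (use right in auto)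
  qed (use left in auto)
qed

lemma mult_eq_iff:
  assumes "a < 9 * s + r" "b < 9 * s + r" "d < 9 * s + r"
  shows "(int a, k) \<otimes>\<^bsub>H\<^esub> (int b, l) = (int d, q) \<longleftrightarrow>
    (a + b = d \<or> a + b = d + (9 * s + r)) \<and> k \<otimes>\<^bsub>K\<^esub> l = q"
proof -
  have "(int a + int b) mod int (9 * s + r) = int ((a + b) mod (9 * s + r))"
    by (simp only: of_nat_add of_nat_mod)
  moreover have "(a + b) mod (9 * s + r) = d \<longleftrightarrow> a + b = d \<or> a + b = d + (9 * s + r)"
    using assms by (auto simp: mod_if)
  ultimately show ?thesis
    by (simp del: of_nat_add of_nat_mult)
qed

lemma chosen_set_carrier:
  assumes "c \<in> admissible"
  shows "chosen_set c \<subseteq> carrier H"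
proof
  fix x assume "x \<in> chosen_set c"
  then obtain a k where x: "x = (int a, k)" and "(a, k) \<in> chosen_pairs c"
    by (auto simp: chosen_set_def)
  then have "a < 9 * s + r" "k \<in> carrier K"
    using chosen_pairs_carrier[OF assms] by blast+
  then show "x \<in> carrier H"
    using r_pos by (simp add: x carrier_integer_mod_group)
qed

lemma sum_free_chosen_set:
  assumes c: "c \<in> admissible"
  shows "sum_free H (chosen_set c)"
  unfolding sum_free_def
proof (intro conjI notI)
  show "chosen_set c \<subseteq> carrier H"
    using chosen_set_carrier[OF c] .
  assume "\<exists>x\<in>chosen_set c. \<exists>y\<in>chosen_set c. \<exists>z\<in>chosen_set c. schur_triple H x y z"
  then obtain a k b l d q where
      mem: "(a, k) \<in> chosen_pairs c" "(b, l) \<in> chosen_pairs c" "(d, q) \<in> chosen_pairs c"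
    and eq: "(int a, k) \<otimes>\<^bsub>H\<^esub> (int b, l) = (int d, q)"
    unfolding chosen_set_def schur_triple_def by fastforce
  have "(a + b = d \<or> a + b = d + (9 * s + r)) \<and> k \<otimes>\<^bsub>K\<^esub> l = q"
    using eq mult_eq_iff chosen_pairs_carrier[OF c] mem by blast
  then show False
    using no_schur_in_chosen_pairs[OF c] mem by blast
qed

text \<open>
  Where two choices disagree, the larger element exceeds the smaller one by \<open>s\<close> or by \<open>2 s\<close>;
  adding \<open>s\<close> to the smaller one, or \<open>-2 s\<close> to the larger one, gives a Schur triple.
\<close>

lemma not_sum_free_chosen_union_if_less:
  assumes c: "c \<in> admissible" and c': "c' \<in> admissible" and x: "(i, k) \<in> columns" and less: "c (i, k) < c' (i, k)"
  shows "\<not> sum_free H (chosen_set c \<union> chosen_set c')"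
proof -
  let ?a = "c (i, k) * s + i" and ?b = "c' (i, k) * s + i"
  have a: "(?a, k) \<in> chosen_pairs c" and b: "(?b, k) \<in> chosen_pairs c'"
    using x by (force simp: chosen_pairs_def vertex_def)+
  have bounds: "?a < 9 * s + r" "?b < 9 * s + r" and k: "k \<in> carrier K"
    using chosen_pairs_carrier c c' a b by blast+
  have J: "c (i, k) \<in> {3, 4, 5}" "c' (i, k) \<in> {3, 4, 5}"
    using c c' x unfolding selections_def by blast+
  have ins: "(s, \<one>\<^bsub>K\<^esub>) \<in> chosen_pairs c" "(7 * s + r, \<one>\<^bsub>K\<^esub>) \<in> chosen_pairs c"
    by (simp_all add: chosen_pairs_def)
  have L: "(int n, l) \<in> chosen_set d" if "(n, l) \<in> chosen_pairs d" for n l d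
    using that by (force simp: chosen_set_def)
  have "schur_triple H (int s, \<one>\<^bsub>K\<^esub>) (int ?a, k) (int ?b, k) \<or>
        schur_triple H (int (7 * s + r), \<one>\<^bsub>K\<^esub>) (int ?b, k) (int ?a, k)"
  proof (cases "c' (i, k) = c (i, k) + 1")
    case True
    then have "(int s, \<one>\<^bsub>K\<^esub>) \<otimes>\<^bsub>H\<^esub> (int ?a, k) = (int ?b, k)"
      using bounds k r_less by (subst mult_eq_iff) auto
    then show ?thesis
      using chosen_set_carrier[OF c] chosen_set_carrier[OF c'] L[OF ins(1)] L[OF a] L[OF b]
      unfolding schur_triple_def by blast
  next
    case False
    then have "c' (i, k) = c (i, k) + 2"
      using J less by auto
    then have "(int (7 * s + r), \<one>\<^bsub>K\<^esub>) \<otimes>\<^bsub>H\<^esub> (int ?b, k) = (int ?a, k)"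
      using bounds k r_less by (subst mult_eq_iff) (auto simp: algebra_simps)
    then show ?thesis
      using chosen_set_carrier[OF c] chosen_set_carrier[OF c'] L[OF ins(2)] L[OF a] L[OF b]
      unfolding schur_triple_def by blast
  qed
  then show ?thesis
    using L[OF ins(1)] L[OF ins(2)] L[OF a] L[OF b]
    unfolding sum_free_def by (metis UnI1 UnI2)
qed

lemma not_sum_free_chosen_union:
  assumes "c \<in> admissible" and "c' \<in> admissible" and "c \<noteq> c'"
  shows "\<not> sum_free H (chosen_set c \<union> chosen_set c')"
proof -
  obtain x where "x \<in> columns" "c x \<noteq> c' x"
    using assms PiE_ext unfolding selections_def by (metis (no_types, lifting) mem_Collect_eq)
  then show ?thesis
    using not_sum_free_chosen_union_if_less[of c c' "fst x" "snd x"]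
      not_sum_free_chosen_union_if_less[of c' c "fst x" "snd x"] assms
    by (metis Un_commute linorder_neqE_nat prod.collapse)
qed

definition exceptional :: "nat set" where
  "exceptional = {i \<in> {1..s}. i = r \<or> i = s \<or> reflect i = i}"

lemma reflect_exceptional: "i \<in> {1..s} \<Longrightarrow> reflect i \<in> exceptional \<longleftrightarrow> i \<in> exceptional"
  using reflect_reflect[of i] reflect_range[of i] r_pos r_less
  by (auto simp: exceptional_def) (auto simp: reflect_def split: if_splits)

text \<open>
  Fixed points of the reflection satisfy \<open>2 i = r\<close> or \<open>2 i = s + r\<close>.  The bound for odd \<open>r\<close> is what
  makes \<open>r = 9\<close> affordable.
\<close>

lemma card_exceptional: "card exceptional \<le> 4" "even r \<or> card exceptional \<le> 3"
proof -
  have sub: "exceptional \<subseteq> {r, s, (s + r) div 2} \<union> {i. 2 * i = r}"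
    using r_less by (auto simp: exceptional_def reflect_def split: if_splits)
  have "card {r, s, (s + r) div 2} \<le> 3"
    by (simp add: card_insert_if)
  moreover have "{i. 2 * i = r} \<subseteq> {r div 2}"
    by auto
  ultimately have "card ({r, s, (s + r) div 2} \<union> {r div 2}) \<le> 4"
    by (intro order_trans[OF card_Un_le]) simp
  moreover have "exceptional \<subseteq> {r, s, (s + r) div 2} \<union> {r div 2}"
    using sub by auto
  ultimately show "card exceptional \<le> 4"
    by (meson card_mono finite_Un finite.emptyI finite.insertI order_trans)
  show "even r \<or> card exceptional \<le> 3"
  proof (cases "even r")
    case False
    then have "exceptional \<subseteq> {r, s, (s + r) div 2}"
      using sub by auto
    then have "card exceptional \<le> card {r, s, (s + r) div 2}"
      by (intro card_mono) auto
    then show ?thesis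
      using \<open>card {r, s, (s + r) div 2} \<le> 3\<close> by simp
  qed simp
qed

lemma card_compatible_pairs:
  assumes "i \<in> {1..s}"
  shows "card {(p, q) \<in> {3, 4, 5} \<times> {3, 4, 5}. compatible (i, k) p q} =
    (if i = r \<or> i = s then 4 else 6)"
proof -
  consider "i < r" | "i = r" | "i = s" | "r < i" "i \<noteq> s"
    by linarith
  then show ?thesis
  proof cases
    case 1
    then have "{(p, q) \<in> {3, 4, 5} \<times> {3, 4, 5}. compatible (i, k) p q} =
        {(3, 3), (3, 5), (4, 4), (4, 5), (5, 3), (5, 4)}"
      using r_less by (auto simp: compatible_def)
    then show ?thesis
      using 1 r_less by simp
  next
    case 2
    then have "{(p, q) \<in> {3, 4, 5} \<times> {3, 4, 5}. compatible (i, k) p q} =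
        {(3, 4), (3, 5), (4, 3), (4, 4)}"
      using r_less by (auto simp: compatible_def)
    then show ?thesis
      using 2 by simp
  next
    case 3
    then have "{(p, q) \<in> {3, 4, 5} \<times> {3, 4, 5}. compatible (i, k) p q} =
        {(4, 3), (5, 3), (3, 4), (4, 4)}"
      using r_less by (auto simp: compatible_def)
    then show ?thesis
      using 3 by simp
  next
    case 4
    then have "{(p, q) \<in> {3, 4, 5} \<times> {3, 4, 5}. compatible (i, k) p q} =
        {(3, 4), (3, 5), (4, 3), (4, 4), (5, 3), (5, 5)}"
      by (auto simp: compatible_def)
    then show ?thesis
      using 4 by simp
  qed
qed

lemma card_compatible_diagonal:
  assumes "i \<in> {1..s}" and "i \<noteq> r" and "i \<noteq> s"
  shows "card {p \<in> {3, 4, 5}. compatible (i, k) p p} = 2"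
proof (cases "i < r")
  case True
  then have "{p \<in> {3, 4, 5}. compatible (i, k) p p} = {3, 4}"
    using assms by (auto simp: compatible_def)
  then show ?thesis by simp
next
  case False
  then have "{p \<in> {3, 4, 5}. compatible (i, k) p p} = {4, 5}"
    using assms by (auto simp: compatible_def)
  then show ?thesis by simp
qed

text \<open>
  The weights are \<open>6\<close> for a column in a prism and \<open>4\<close> for an exceptional one.  They depend on \<open>i\<close> only: a
  column with \<open>reflect i = i\<close> is linked to itself only if also \<open>k\<close> is its own inverse, and otherwise
  has six choices with its partner, more than enough for weight \<open>4\<close>.
\<close>

lemma card_admissible_ge:
  "(6 ^ (s - card exceptional) * 4 ^ card exceptional) ^ card (carrier K) \<le> (card admissible)\<^sup>2"
proof -
  let ?w = "\<lambda>i. if i \<in> exceptional then 4 else (6::nat)"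
  have ends: "reflect r = s" "reflect s = r"
    using r_pos r_less by (auto simp: reflect_def)
  have swap: "reflect i = r \<longleftrightarrow> i = s" "reflect i = s \<longleftrightarrow> i = r" if "i \<in> {1..s}" for i
    using reflect_reflect[OF that] ends by auto
  have "(\<Prod>x\<in>columns. ?w (fst x)) \<le> (card admissible)\<^sup>2"
  proof (rule card_selections_ge)
    show "finite columns"
      using finK by (simp add: columns_def)
    show "partner x \<in> columns \<and> partner (partner x) = x" if "x \<in> columns" for x
      using that reflect_range reflect_reflect by (auto simp: columns_def partner_def simp del: atLeastAtMost_iff)
    show "compatible (partner x) q p" if "x \<in> columns" "compatible x p q" for x p q
    proof -
      obtain i k where x: "x = (i, k)" "i \<in> {1..s}"
        using \<open>x \<in> columns\<close> by (auto simp: columns_def)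
      have "reflect i < r \<longleftrightarrow> i < r"
        using x(2) r_pos by (auto simp: reflect_def)
      then show ?thesis
        using that(2) swap[OF x(2)] by (auto simp: x(1) compatible_def partner_def add.commute)
    qed
    show "?w (fst x) * ?w (fst (partner x)) \<le>
        (card {(p, q) \<in> {3, 4, 5} \<times> {3, 4, 5}. compatible x p q})\<^sup>2" if "x \<in> columns" for x
    proof -
      obtain i k where x: "x = (i, k)" "i \<in> {1..s}"
        using \<open>x \<in> columns\<close> by (auto simp: columns_def)
      have "i \<in> exceptional" if "i = r \<or> i = s"
        using that x(2) by (auto simp: exceptional_def)
      then show ?thesis
        unfolding x(1) card_compatible_pairs[OF x(2)]
        using reflect_exceptional[OF x(2)] by (auto simp: partner_def)
    qed
    show "?w (fst x) \<le> (card {p \<in> {3, 4, 5}. compatible x p p})\<^sup>2"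
      if "x \<in> columns" "partner x = x" for x
    proof -
      obtain i k where x: "x = (i, k)" "i \<in> {1..s}"
        using \<open>x \<in> columns\<close> by (auto simp: columns_def)
      have i: "reflect i = i"
        using that(2) by (simp add: x(1) partner_def)
      then have "i \<noteq> r" "i \<noteq> s"
        using ends r_less by auto
      moreover have "i \<in> exceptional"
        using i x(2) by (simp add: exceptional_def)
      ultimately show ?thesis
        unfolding x(1) card_compatible_diagonal[OF x(2) \<open>i \<noteq> r\<close> \<open>i \<noteq> s\<close>] by simp
    qed
  qed auto
  also have "(\<Prod>x\<in>columns. ?w (fst x)) = (\<Prod>i\<in>{1..s}. \<Prod>k\<in>carrier K. ?w i)"
    unfolding columns_def prod.cartesian_product by (simp add: case_prod_beta)
  also have "\<dots> = (\<Prod>i\<in>{1..s}. ?w i) ^ card (carrier K)"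
    by (simp add: prod_power_distrib)
  also have "(\<Prod>i\<in>{1..s}. ?w i) = 6 ^ (s - card exceptional) * 4 ^ card exceptional"
  proof -
    have sub: "exceptional \<subseteq> {1..s}"
      by (auto simp: exceptional_def)
    then have "(\<Prod>i\<in>{1..s}. ?w i) = (\<Prod>i\<in>{1..s} - exceptional. ?w i) * (\<Prod>i\<in>exceptional. ?w i)"
      by (intro prod.subset_diff) auto
    also have "(\<Prod>i\<in>{1..s} - exceptional. ?w i) = 6 ^ card ({1..s} - exceptional)"
      by simp
    also have "card ({1..s} - exceptional) = s - card exceptional"
      using card_Diff_subset[OF finite_subset[OF sub] sub] by simp
    finally show ?thesis
      by simp
  qed
  finally show ?thesis .
qed

lemma f_max_ge_card_admissible:
  assumes fin: "finite (carrier G)" and h: "h \<in> iso H G"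
  shows "card admissible \<le> f_max G"
proof -
  have grp: "group H"
    by (simp add: DirProd_group)
  show ?thesis
  proof (rule card_incompatible_le_f_max[OF fin, of admissible "\<lambda>c. h ` chosen_set c"])
    show "sum_free G (h ` chosen_set c)" if "c \<in> admissible" for c
      using sum_free_iso_image[OF h chosen_set_carrier[OF that] grp] sum_free_chosen_set[OF that] by simp
    show "\<not> sum_free G (h ` chosen_set c \<union> h ` chosen_set c')" if "c \<in> admissible" "c' \<in> admissible" "c \<noteq> c'" for c c'
      using sum_free_iso_image[OF h _ grp, of "chosen_set c \<union> chosen_set c'"] chosen_set_carrier that
        not_sum_free_chosen_union[OF that] by (simp add: image_Un)
  qed
qed

end

section \<open>The lower bound\<close>

theorem proposition5p2:
  fixes G :: "('a, 'c) monoid_scheme"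
    and K :: "('b, 'd) monoid_scheme"
    and m n :: nat
  assumes "comm_group G"
    and "finite (carrier G)"
    and "order G = n"
    and "m \<ge> 3084"
    and "comm_group K"
    and "G \<cong> integer_mod_group m \<times>\<times> K"
  shows "real (f_max G) \<ge> 2 powr (real n / 7)"
proof -
  interpret G: comm_group G by fact
  interpret K: comm_group K by fact
  \<comment> \<open>Shifting by one before the division makes \<open>r\<close> range over \<open>{1..9}\<close>.\<close>
  define s r where "s = (m - 1) div 9" and "r = (m - 1) mod 9 + 1"
  have m: "m = 9 * s + r" and r: "1 \<le> r" "r \<le> 9" and s: "342 \<le> s"
    using assms(4) by (auto simp: s_def r_def)
  obtain g where g: "g \<in> iso G (integer_mod_group m \<times>\<times> K)"
    using assms(6) by (auto simp: is_iso_def)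
  define h where "h = inv_into (carrier G) g"
  have h: "h \<in> iso (integer_mod_group m \<times>\<times> K) G"
    unfolding h_def by (rule G.iso_set_sym[OF g])
  have bij: "bij_betw g (carrier G) ({0..<int m} \<times> carrier K)"
    using g assms(4) by (simp add: iso_def carrier_integer_mod_group)
  then have "finite ({0..<int m} \<times> carrier K)"
    using assms(2) bij_betw_finite by blast
  then have finK: "finite (carrier K)"
    using finite_cartesian_productD2[of "{0..<int m}" "carrier K"] assms(4) by auto
  have n: "n = m * card (carrier K)"
    using bij_betw_same_card[OF bij] assms(3) by (simp add: order_def card_cartesian_product)
  interpret column_decomposition K s r
    using finK r s by unfold_locales auto
  let ?N = "f_max G" and ?P = "6 ^ (s - card exceptional) * 4 ^ card exceptional :: nat"
  have "?P ^ card (carrier K) \<le> (card admissible)\<^sup>2"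
    by (rule card_admissible_ge)
  also have "\<dots> \<le> ?N\<^sup>2"
    using f_max_ge_card_admissible[OF assms(2) h[unfolded m]] by (rule power_mono) simp
  finally have P: "?P ^ card (carrier K) \<le> ?N\<^sup>2" .
  have "r \<le> 8 \<or> card exceptional \<le> 3"
  proof (cases "r \<le> 8")
    case False
    then have "r = 9" using r by simp
    then show ?thesis using card_exceptional(2) by auto
  qed simp
  then have "(4::nat) ^ m \<le> ?P ^ 7"
    unfolding m using four_power_le_six_power_product[OF s card_exceptional(1) r(2)] by blast
  then have "((4::nat) ^ m) ^ card (carrier K) \<le> (?P ^ 7) ^ card (carrier K)"
    by (rule power_mono) simp
  also have "\<dots> = (?P ^ card (carrier K)) ^ 7"
    by (simp only: power_mult[symmetric] mult.commute)
  also have "\<dots> \<le> (?N\<^sup>2) ^ 7"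
    using P by (rule power_mono) simp
  finally have "(4::nat) ^ n \<le> (?N\<^sup>2) ^ 7"
    unfolding n power_mult .
  moreover have "(4::nat) ^ n = (2 ^ n)\<^sup>2"
    by (simp add: power2_eq_square flip: power_mult_distrib)
  ultimately have "((2::nat) ^ n)\<^sup>2 \<le> (?N ^ 7)\<^sup>2"
    by (simp only: power_mult[symmetric] mult.commute)
  then have "(2::nat) ^ n \<le> ?N ^ 7"
    by (rule power2_le_imp_le) simp
  then have "(2::real) ^ n \<le> real ?N ^ 7"
    by (metis of_nat_le_iff of_nat_numeral of_nat_power)
  then have "(2 powr (real n / 7)) ^ 7 \<le> real ?N ^ 7"
    by (simp add: powr_power powr_realpow)
  then show ?thesis
    by (rule power_le_imp_le_base[of _ 6, simplified]) simp
qed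

end
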